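(* Let $\alpha\in(0,1)$, $\lambda>0$, $\mu\ge 0$, $\Lambda>0$, $c>0$, $d>0$, and $D=[0,1]$. Consider the Hamilton--Jacobi--Bellman equation for the unknown pair $(H,\Phi)$, $$H+\chi_{\{x>0\}}\,\mathcal{A}\Phi(x)+\Lambda\left(\Phi(x)-\min_{\eta\in\Xi_2(x)}\left\{\Phi(x+\eta)+c\eta+d\chi_{\{\eta>0\}}\right\}\right)-\chi_{\{x=0\}}=0,\qquad x\in D,\qquad \Phi(0)=0,$$ where, for $x\in(0,1]$, $$\mathcal{A}\Phi(x)=\left(\mu+\frac{\lambda}{1-\alpha}\right)x^{1-\alpha}\frac{\mathrm{d}\Phi(x)}{\mathrm{d}x}+\int_{(0,x)}\left\{\Phi(x)-\Phi(x-z)-z\frac{\mathrm{d}\Phi(x)}{\mathrm{d}x}\right\}\lambda z^{-(\alpha+1)}\,\mathrm{d}z+\frac{\lambda}{\alpha}x^{-\alpha}\Phi(x).$$ Then this equation admits the classical solution $(\hat H,\hat\Phi)$ given by $$\hat H=\frac{1+\Lambda\min\{c+d,\kappa\}}{1+\kappa\Lambda}\in\left(\frac{1}{1+\kappa\Lambda},1\right],\qquad \hat\Phi(x)=-\kappa\hat H x^{\alpha}\in C(D)\cap C^1((0,1]),$$ with $$\kappa=\left\{\mu\alpha+\lambda\left(\frac{\alpha}{1-\alpha}+\frac1\alpha+I_\alpha\right)\right\}^{-1}>0,\qquad I_\alpha=\int_{(0,1)}\frac{1-(1-u)^\alpha-\alpha u}{u^{1+\alpha}}\,\mathrm{d}u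<0.$$
   Context: $\chi_A$ is the indicator of a condition $A$ (equal to $1$ if $A$ is true and $0$ otherwise). For $x\in D$ the set of admissible interventions is $\Xi_2(0)=\{0,1\}$ and $\Xi_2(x)=\{0\}$ for $x\in(0,1]$. The term $\chi_{\{x>0\}}\mathcal{A}\Phi(x)$ is understood to be $0$ at $x=0$. A solution is a pair $(H,\Phi)\in\mathbb{R}\times C(D)$; it is a classical solution if $\Phi\in C(D)\cap C^1((0,1])$ and the equation is satisfied pointwise at every $x\in D$.
   Formalization: The claim I_α < 0 is replaced by I_α > 0: since (1-u)^α < 1-αu for 0<u<1, the integrand is strictly positive for every α in (0,1) (for α=1/2, I_α = π-3 > 0); all other claims are kept as stated. *)

theory Defs
  imports "HOL-Analysis.Analysis"
begin

definition Xi2 :: "real \<Rightarrow> real set" where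
  "Xi2 x = (if x = 0 then {0, 1} else {0})"

text \<open>
  Functions on \<open>D = [0,1]\<close> are represented by functions on the reals of which only the values
  on \<open>{0..1}\<close> matter. The derivative is therefore taken within \<open>{0..1}\<close>, so at \<open>x = 1\<close> it is
  the left derivative.
\<close>

definition dD :: "(real \<Rightarrow> real) \<Rightarrow> real \<Rightarrow> real" where
  "dD \<Phi> x = vector_derivative \<Phi> (at x within {0..1})"

definition jump_integrand :: "real \<Rightarrow> real \<Rightarrow> (real \<Rightarrow> real) \<Rightarrow> real \<Rightarrow> real \<Rightarrow> real" where
  "jump_integrand \<alpha> lam \<Phi> x z =
     (\<Phi> x - \<Phi> (x - z) - z * dD \<Phi> x) * (lam * z powr (- (\<alpha> + 1)))"

definition gen :: "real \<Rightarrow> real \<Rightarrow> real \<Rightarrow> (real \<Rightarrow> real) \<Rightarrow> real \<Rightarrow> real" where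
  "gen \<alpha> lam \<mu> \<Phi> x =
     (\<mu> + lam / (1 - \<alpha>)) * x powr (1 - \<alpha>) * dD \<Phi> x
     + (LBINT z:{0<..<x}. jump_integrand \<alpha> lam \<Phi> x z)
     + lam / \<alpha> * x powr (- \<alpha>) * \<Phi> x"

text \<open>
  The indicator of a condition is \<open>of_bool\<close>. Since \<open>gen\<close> is a total function, the product
  with \<open>of_bool (x > 0)\<close> is \<open>0\<close> at \<open>x = 0\<close>.
\<close>

definition hjb_lhs ::
  "real \<Rightarrow> real \<Rightarrow> real \<Rightarrow> real \<Rightarrow> real \<Rightarrow> real \<Rightarrow> real \<Rightarrow> (real \<Rightarrow> real) \<Rightarrow> real \<Rightarrow> real" where
  "hjb_lhs \<alpha> lam \<mu> \<Lambda> c d H \<Phi> x =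
     H + of_bool (x > 0) * gen \<alpha> lam \<mu> \<Phi> x
     + \<Lambda> * (\<Phi> x - Min ((\<lambda>\<eta>. \<Phi> (x + \<eta>) + c * \<eta> + d * of_bool (\<eta> > 0)) ` Xi2 x))
     - of_bool (x = 0)"

text \<open>
  A Lebesgue integral is \<open>0\<close> by convention when the integrand is not integrable; the
  integrability clause ensures that \<open>gen\<close> is well defined at every \<open>x > 0\<close>.
\<close>

definition classical_solution ::
  "real \<Rightarrow> real \<Rightarrow> real \<Rightarrow> real \<Rightarrow> real \<Rightarrow> real \<Rightarrow> real \<Rightarrow> (real \<Rightarrow> real) \<Rightarrow> bool" where
  "classical_solution \<alpha> lam \<mu> \<Lambda> c d H \<Phi> \<longleftrightarrow>
     continuous_on {0..1} \<Phi> \<and>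
     (\<forall>x\<in>{0<..1}. \<Phi> differentiable (at x within {0..1})) \<and>
     continuous_on {0<..1} (dD \<Phi>) \<and>
     (\<forall>x\<in>{0<..1}. set_integrable lborel {0<..<x} (jump_integrand \<alpha> lam \<Phi> x)) \<and>
     (\<forall>x\<in>{0..1}. hjb_lhs \<alpha> lam \<mu> \<Lambda> c d H \<Phi> x = 0) \<and>
     \<Phi> 0 = 0"

definition I_integrand :: "real \<Rightarrow> real \<Rightarrow> real" where
  "I_integrand \<alpha> u = (1 - (1 - u) powr \<alpha> - \<alpha> * u) / u powr (1 + \<alpha>)"

text \<open>
  For \<open>0 < \<alpha> < 1\<close> the integrand is positive on \<open>(0,1)\<close> because \<open>(1 - u) powr \<alpha> < 1 - \<alpha> * u\<close>
  by Bernoulli's inequality. Hence \<open>I_alpha \<alpha> > 0\<close>; the source states the opposite sign.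
\<close>

definition I_alpha :: "real \<Rightarrow> real" where
  "I_alpha \<alpha> = (LBINT u:{0<..<1}. I_integrand \<alpha> u)"

definition kappa :: "real \<Rightarrow> real \<Rightarrow> real \<Rightarrow> real" where
  "kappa \<alpha> lam \<mu> = inverse (\<mu> * \<alpha> + lam * (\<alpha> / (1 - \<alpha>) + 1 / \<alpha> + I_alpha \<alpha>))"

definition H_hat :: "real \<Rightarrow> real \<Rightarrow> real \<Rightarrow> real \<Rightarrow> real \<Rightarrow> real \<Rightarrow> real" where
  "H_hat \<alpha> lam \<mu> \<Lambda> c d =
     (1 + \<Lambda> * min (c + d) (kappa \<alpha> lam \<mu>)) / (1 + kappa \<alpha> lam \<mu> * \<Lambda>)"

definition Phi_hat :: "real \<Rightarrow> real \<Rightarrow> real \<Rightarrow> real \<Rightarrow> real \<Rightarrow> real \<Rightarrow> real \<Rightarrow> real" where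
  "Phi_hat \<alpha> lam \<mu> \<Lambda> c d x = - kappa \<alpha> lam \<mu> * H_hat \<alpha> lam \<mu> \<Lambda> c d * x powr \<alpha>"

end

theory Submission
  imports Defs
begin

text \<open>
  The substitution \<open>z = x * u\<close> shows that the operator \<open>gen\<close> maps \<open>K * x powr \<alpha>\<close> to the
  constant \<open>K / \<kappa>\<close>, so that the equation holds on \<open>(0,1]\<close> for \<open>K = - \<kappa> * H\<close>. At \<open>x = 0\<close> it
  becomes the scalar equation \<open>H = 1 + \<Lambda> * min 0 (c + d - \<kappa> * H)\<close>, whose solution is \<open>H_hat\<close>.
\<close>

text \<open>The difference of the two sides vanishes at 0 and has derivative \<alpha> ((1 -
  t)^(\<alpha> - 1) - 1), positive because the base is below 1 and the exponent is negative.
  Strictness is what later gives \<open>I_alpha\<close> a definite sign.\<close>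

lemma powr_one_minus_less:
  fixes \<alpha> u :: real
  assumes "0 < \<alpha>" "\<alpha> < 1" "0 < u" "u < 1"
  shows "(1 - u) powr \<alpha> < 1 - \<alpha> * u"
proof -
  let ?f = "\<lambda>u::real. 1 - (1 - u) powr \<alpha> - \<alpha> * u"
  have "?f 0 < ?f u"
  proof (rule DERIV_pos_imp_increasing_open [OF \<open>0 < u\<close>])
    fix t assume t: "0 < t" "t < u"
    then have t1: "t < 1" using assms by simp
    have "(?f has_real_derivative \<alpha> * (1 - t) powr (\<alpha> - 1) - \<alpha>) (at t)"
      using t1 by (auto intro!: derivative_eq_intros)
    moreover have "(1 - t) powr 0 < (1 - t) powr (\<alpha> - 1)"
      using t t1 assms by (intro powr_less_mono') auto
    then have "0 < \<alpha> * (1 - t) powr (\<alpha> - 1) - \<alpha>"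
      using t1 assms by simp
    ultimately show "\<exists>y. (?f has_real_derivative y) (at t) \<and> 0 < y" by blast
  qed (use assms in \<open>auto intro!: continuous_intros\<close>)
  then show ?thesis by simp
qed

lemma I_integrand_pos:
  assumes "0 < \<alpha>" "\<alpha> < 1" "u \<in> {0<..<1}"
  shows "0 < I_integrand \<alpha> u"
  using powr_one_minus_less [of \<alpha> u] assms by (auto simp: I_integrand_def)

text \<open>Since 1 - u lies in (0,1) and \<alpha> < 1, the power (1 - u)^\<alpha> is at least 1 -
  u, so the numerator is at most u. This crude bound suffices as a dominating function because
  u^(-\<alpha>) is integrable at 0.\<close>

lemma I_integrand_le:
  assumes "0 < \<alpha>" "\<alpha> < 1" "u \<in> {0<..<1}"
  shows "I_integrand \<alpha> u \<le> u powr (- \<alpha>)"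
proof -
  have "1 - u \<le> (1 - u) powr \<alpha>"
    using assms powr_mono' [of \<alpha> 1 "1 - u"] by simp
  moreover have "0 \<le> \<alpha> * u" using assms by simp
  ultimately have "1 - (1 - u) powr \<alpha> - \<alpha> * u \<le> u"
    by linarith
  then have "I_integrand \<alpha> u \<le> u / u powr (1 + \<alpha>)"
    unfolding I_integrand_def by (intro divide_right_mono) auto
  also have "\<dots> = u powr (- \<alpha>)"
    using assms by (simp add: powr_add powr_minus field_simps)
  finally show ?thesis .
qed

lemma set_integrable_I_integrand:
  assumes "0 < \<alpha>" "\<alpha> < 1"
  shows "set_integrable lborel {0<..<1} (I_integrand \<alpha>)"
proof (rule set_integrable_bound)
  have "((\<lambda>u. u powr (- \<alpha>)) has_integral (1 powr (- \<alpha> + 1) / (- \<alpha> + 1))) {0..1}"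
    using assms by (intro has_integral_powr_from_0) auto
  then have "(\<lambda>u. u powr (- \<alpha>)) absolutely_integrable_on {0..1}"
    by (intro nonnegative_absolutely_integrable_1) auto
  \<comment> \<open>Absolute integrability refers to the completed measure; Borel measurability of
    the function brings it back to \<open>lborel\<close>.\<close>
  then have "set_integrable lborel {0..1} (\<lambda>u. u powr (- \<alpha>))"
    by (simp add: set_integrable_def integrable_completion)
  then show "set_integrable lborel {0<..<1} (\<lambda>u. u powr (- \<alpha>))"
    by (rule set_integrable_subset) auto
  show "set_borel_measurable lborel {0<..<1} (I_integrand \<alpha>)"
    unfolding set_borel_measurable_def I_integrand_def by measurable
  show "AE u in lborel. u \<in> {0<..<1} \<longrightarrow> norm (I_integrand \<alpha> u) \<le> norm (u powr (- \<alpha>))"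
    using I_integrand_le [OF assms] I_integrand_pos [OF assms] by (fastforce intro!: AE_I2)
qed

text \<open>A nonnegative integrand with zero integral vanishes almost everywhere, but this one is
  strictly positive on (0,1), a set of measure 1.\<close>

lemma I_alpha_pos:
  assumes "0 < \<alpha>" "\<alpha> < 1"
  shows "0 < I_alpha \<alpha>"
proof -
  let ?g = "\<lambda>u. indicator {0<..<1} u *\<^sub>R I_integrand \<alpha> u"
  have int: "integrable lborel ?g"
    using set_integrable_I_integrand [OF assms] by (simp add: set_integrable_def)
  have nonneg: "0 \<le> ?g u" for u
    using I_integrand_pos [OF assms, of u] by (auto simp: indicator_def)
  have "integral\<^sup>L lborel ?g \<noteq> 0"
  proof
    assume "integral\<^sup>L lborel ?g = 0"
    then have "AE u in lborel. ?g u = 0"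
      using integral_nonneg_eq_0_iff_AE [OF int] nonneg by auto
    then have "AE u in lborel. u \<notin> {0<..<1::real}"
      by (rule AE_mp) (use I_integrand_pos [OF assms] in \<open>fastforce intro!: AE_I2\<close>)
    then have "emeasure lborel {0<..<1::real} = 0"
      by (subst (asm) AE_iff_measurable [of "{0<..<1}"]) auto
    then show False by simp
  qed
  moreover have "0 \<le> integral\<^sup>L lborel ?g"
    using nonneg by (intro integral_nonneg_AE) auto
  ultimately show ?thesis by (simp add: I_alpha_def set_lebesgue_integral_def)
qed

lemma kappa_pos:
  assumes "0 < \<alpha>" "\<alpha> < 1" "0 < lam" "0 \<le> \<mu>"
  shows "0 < kappa \<alpha> lam \<mu>"
proof -
  have "0 < lam * (\<alpha> / (1 - \<alpha>) + 1 / \<alpha> + I_alpha \<alpha>)"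
    using assms I_alpha_pos [of \<alpha>] by (intro mult_pos_pos add_pos_pos) auto
  then show ?thesis
    unfolding kappa_def using assms by (intro positive_imp_inverse_positive add_nonneg_pos) auto
qed

lemma has_vector_derivative_const_mult_powr:
  fixes x :: real
  assumes "0 < x"
  shows "((\<lambda>x. K * x powr \<alpha>) has_vector_derivative K * \<alpha> * x powr (\<alpha> - 1)) (at x within A)"
proof -
  have "((\<lambda>x. K * x powr \<alpha>) has_real_derivative K * \<alpha> * x powr (\<alpha> - 1)) (at x within A)"
    using assms by (auto intro!: derivative_eq_intros)
  then show ?thesis
    by (simp add: has_real_derivative_iff_has_vector_derivative)
qed

text \<open>Derivatives within a nondegenerate closed interval are unique at every point, so the
  endpoint x = 1 needs no separate treatment.\<close>

lemma dD_const_mult_powr: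
  assumes "x \<in> {0<..1}"
  shows "dD (\<lambda>x. K * x powr \<alpha>) x = K * \<alpha> * x powr (\<alpha> - 1)"
  unfolding dD_def
  by (rule vector_derivative_within_closed_interval)
     (use assms has_vector_derivative_const_mult_powr in auto)

text \<open>By homogeneity the bracket is K x^\<alpha> times the numerator of
  \<open>I_integrand\<close>, and the kernel contributes x^(-\<alpha> - 1). The remaining 1 / x is
  cancelled later by dz = x du.\<close>

lemma jump_integrand_scale:
  assumes "x \<in> {0<..1}" "u \<in> {0<..<1}"
  shows "jump_integrand \<alpha> lam (\<lambda>x. K * x powr \<alpha>) x (x * u) = K * lam / x * I_integrand \<alpha> u"
proof -
  have "x - x * u = x * (1 - u)" by (simp add: algebra_simps)
  then have "(x - x * u) powr \<alpha> = x powr \<alpha> * (1 - u) powr \<alpha>"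
    using assms by (simp add: powr_mult)
  moreover have "x powr (\<alpha> - 1) = x powr \<alpha> / x"
    using assms by (simp add: powr_diff)
  moreover have "(x * u) powr (- (\<alpha> + 1)) = 1 / (x powr \<alpha> * x * u powr (1 + \<alpha>))"
    unfolding powr_minus using assms by (simp add: powr_mult powr_add field_simps)
  moreover have "x powr \<alpha> > 0" "u powr (1 + \<alpha>) > 0" using assms by auto
  ultimately show ?thesis
    using assms
    by (simp only: jump_integrand_def dD_const_mult_powr I_integrand_def) (simp add: field_simps)
qed

text \<open>The form \<open>0 + x * u\<close> and the explicit indicators match the affine change of
  variables, which is stated for integrals over the whole line.\<close>

lemma indicator_jump_integrand_scale:
  assumes "x \<in> {0<..1}"
  shows "indicator {0<..<x} (0 + x * u) *\<^sub>R jump_integrand \<alpha> lam (\<lambda>x. K * x powr \<alpha>) x (0 + x * u)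
    = K * lam / x * (indicator {0<..<1} u *\<^sub>R I_integrand \<alpha> u)"
proof -
  have "0 + x * u \<in> {0<..<x} \<longleftrightarrow> u \<in> {0<..<1}"
    using assms by (auto simp: zero_less_mult_iff)
  then show ?thesis
    using jump_integrand_scale [OF assms, of u] by (auto simp: indicator_def)
qed

lemma set_integrable_jump_integrand:
  assumes "0 < \<alpha>" "\<alpha> < 1" "x \<in> {0<..1}"
  shows "set_integrable lborel {0<..<x} (jump_integrand \<alpha> lam (\<lambda>x. K * x powr \<alpha>) x)"
  unfolding set_integrable_def
  using assms set_integrable_I_integrand [OF assms(1,2)]
  by (subst lborel_integrable_real_affine_iff [where c = x and t = 0, symmetric])
     (simp, unfold indicator_jump_integrand_scale [OF assms(3)],
      auto simp only: set_integrable_def intro!: integrable_mult_right)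

lemma integral_jump_integrand:
  assumes "x \<in> {0<..1}"
  shows "(LBINT z:{0<..<x}. jump_integrand \<alpha> lam (\<lambda>x. K * x powr \<alpha>) x z) = K * lam * I_alpha \<alpha>"
  unfolding set_lebesgue_integral_def
  using assms
  by (subst lborel_integral_real_affine [where c = x and t = 0])
     (simp, unfold indicator_jump_integrand_scale [OF assms],
      simp add: I_alpha_def set_lebesgue_integral_def)

text \<open>The powers of x cancel in each of the three terms, and the constants left over sum to K
  times the expression whose inverse defines \<open>kappa\<close>.\<close>

lemma gen_const_mult_powr:
  assumes "x \<in> {0<..1}"
  shows "gen \<alpha> lam \<mu> (\<lambda>x. K * x powr \<alpha>) x = K * inverse (kappa \<alpha> lam \<mu>)"
proof -
  have "x powr (1 - \<alpha>) * x powr (\<alpha> - 1) = 1" "x powr (- \<alpha>) * x powr \<alpha> = 1"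
    using assms by (simp_all flip: powr_add)
  then have "(\<mu> + lam / (1 - \<alpha>)) * x powr (1 - \<alpha>) * (K * \<alpha> * x powr (\<alpha> - 1))
      = (\<mu> + lam / (1 - \<alpha>)) * (K * \<alpha>)"
    and "lam / \<alpha> * x powr (- \<alpha>) * (K * x powr \<alpha>) = lam / \<alpha> * K"
    by (metis (no_types, lifting) mult.assoc mult.commute mult_1_right)+
  then show ?thesis
    unfolding gen_def integral_jump_integrand [OF assms] dD_const_mult_powr [OF assms] kappa_def
    by (simp add: algebra_simps)
qed

text \<open>The cases say whether intervening at 0 strictly pays. If \<kappa> \<le> c + d, then H =
  1 and the minimum is 0. Otherwise c + d - \<kappa> H has the sign of c + d - \<kappa>, which is
  negative, and the equation is linear in H.\<close>

lemma H_hat_eq: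
  assumes "0 < kappa \<alpha> lam \<mu>" "0 < \<Lambda>"
  shows "H_hat \<alpha> lam \<mu> \<Lambda> c d = 1 + \<Lambda> * min 0 (c + d - kappa \<alpha> lam \<mu> * H_hat \<alpha> lam \<mu> \<Lambda> c d)"
proof -
  define k where "k = kappa \<alpha> lam \<mu>"
  have pos: "0 < 1 + k * \<Lambda>" using assms by (simp add: k_def add_pos_pos)
  show ?thesis
  proof (cases "k \<le> c + d")
    case True
    then have "H_hat \<alpha> lam \<mu> \<Lambda> c d = 1"
      using pos by (simp add: H_hat_def k_def [symmetric] min_absorb2 mult.commute)
    then show ?thesis using True by (simp add: k_def)
  next
    case False
    then have H: "H_hat \<alpha> lam \<mu> \<Lambda> c d = (1 + \<Lambda> * (c + d)) / (1 + k * \<Lambda>)"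
      by (simp add: H_hat_def k_def)
    have eq: "c + d - k * H_hat \<alpha> lam \<mu> \<Lambda> c d = (c + d - k) / (1 + k * \<Lambda>)"
      unfolding H using pos by (simp add: field_simps)
    also have "\<dots> < 0" using False pos by (simp add: divide_neg_pos)
    finally have min: "min 0 (c + d - k * H_hat \<alpha> lam \<mu> \<Lambda> c d) = (c + d - k) / (1 + k * \<Lambda>)"
      using eq by simp
    show ?thesis
      unfolding k_def [symmetric] min unfolding H using pos by (simp add: field_simps)
  qed
qed

lemma H_hat_bounds:
  assumes "0 < kappa \<alpha> lam \<mu>" "0 < \<Lambda>" "0 < c" "0 < d"
  shows "H_hat \<alpha> lam \<mu> \<Lambda> c d \<in> {1 / (1 + kappa \<alpha> lam \<mu> * \<Lambda>)<..1}"
proof -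
  have pos: "0 < 1 + kappa \<alpha> lam \<mu> * \<Lambda>" using assms by (simp add: add_pos_pos)
  have "0 < \<Lambda> * min (c + d) (kappa \<alpha> lam \<mu>)" using assms by simp
  moreover have "\<Lambda> * min (c + d) (kappa \<alpha> lam \<mu>) \<le> \<Lambda> * kappa \<alpha> lam \<mu>"
    using assms by (intro mult_left_mono) auto
  ultimately show ?thesis
    unfolding H_hat_def using pos by (auto simp: divide_strict_right_mono mult.commute)
qed

lemma hjb_lhs_const_mult_powr:
  assumes "x \<in> {0..1}" "0 < \<alpha>" "kappa \<alpha> lam \<mu> \<noteq> 0"
    and H: "H = 1 + \<Lambda> * min 0 (c + d - kappa \<alpha> lam \<mu> * H)"
  shows "hjb_lhs \<alpha> lam \<mu> \<Lambda> c d H (\<lambda>x. - kappa \<alpha> lam \<mu> * H * x powr \<alpha>) x = 0"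
proof (cases "x = 0")
  case True
  \<comment> \<open>The right side is the minimum over \<open>Xi2 0\<close>: \<eta> = 0 costs
    \<Phi>(0) = 0, and \<eta> = 1 costs \<Phi>(1) + c + d.\<close>
  have "min 0 (c + d - kappa \<alpha> lam \<mu> * H) = min 0 (- (kappa \<alpha> lam \<mu> * H) + c + d)"
    by (simp add: algebra_simps)
  then show ?thesis
    using H True by (simp add: hjb_lhs_def Xi2_def)
next
  case False
  then have "x \<in> {0<..1}" using assms by auto
  from gen_const_mult_powr [OF this, of \<alpha> lam \<mu> "- kappa \<alpha> lam \<mu> * H"] assms
  have "gen \<alpha> lam \<mu> (\<lambda>x. - kappa \<alpha> lam \<mu> * H * x powr \<alpha>) x = - H" by simp
  \<comment> \<open>For x > 0 the only choice is \<eta> = 0, so the \<Lambda> term vanishes and H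
    cancels against the generator.\<close>
  then show ?thesis
    using False assms by (simp add: hjb_lhs_def Xi2_def)
qed

theorem proposition1:
  fixes \<alpha> lam \<mu> \<Lambda> c d :: real
  assumes "0 < \<alpha>" and "\<alpha> < 1" and "lam > 0" and "\<mu> \<ge> 0" and "\<Lambda> > 0" and "c > 0" and "d > 0"
  shows "classical_solution \<alpha> lam \<mu> \<Lambda> c d
           (H_hat \<alpha> lam \<mu> \<Lambda> c d) (Phi_hat \<alpha> lam \<mu> \<Lambda> c d)
    \<and> H_hat \<alpha> lam \<mu> \<Lambda> c d \<in> {1 / (1 + kappa \<alpha> lam \<mu> * \<Lambda>)<..1}
    \<and> kappa \<alpha> lam \<mu> > 0
    \<and> set_integrable lborel {0<..<1} (I_integrand \<alpha>)
    \<and> I_alpha \<alpha> > 0"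
proof -
  have kappa: "0 < kappa \<alpha> lam \<mu>" using assms by (intro kappa_pos)
  define H where "H = H_hat \<alpha> lam \<mu> \<Lambda> c d"
  define K where "K = - kappa \<alpha> lam \<mu> * H"
  have Phi: "Phi_hat \<alpha> lam \<mu> \<Lambda> c d = (\<lambda>x. K * x powr \<alpha>)"
    by (simp add: fun_eq_iff Phi_hat_def K_def H_def)
  have "classical_solution \<alpha> lam \<mu> \<Lambda> c d H (\<lambda>x. K * x powr \<alpha>)"
    unfolding classical_solution_def
  proof (intro conjI ballI)
    \<comment> \<open>Continuity at 0 relies on \<alpha> > 0.\<close>
    show "continuous_on {0..1} (\<lambda>x. K * x powr \<alpha>)"
      using assms by (auto intro!: continuous_intros continuous_on_powr')
    show "(\<lambda>x. K * x powr \<alpha>) differentiable (at x within {0..1})" if "x \<in> {0<..1}" for x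
      using that by (simp add: differentiableI_vector [OF has_vector_derivative_const_mult_powr])
    have "continuous_on {0<..1} (\<lambda>x. K * \<alpha> * x powr (\<alpha> - 1))"
      by (auto intro!: continuous_intros)
    then show "continuous_on {0<..1} (dD (\<lambda>x. K * x powr \<alpha>))"
      by (subst continuous_on_cong [OF refl dD_const_mult_powr])
    show "set_integrable lborel {0<..<x} (jump_integrand \<alpha> lam (\<lambda>x. K * x powr \<alpha>) x)"
      if "x \<in> {0<..1}" for x
      using assms that by (intro set_integrable_jump_integrand)
    show "hjb_lhs \<alpha> lam \<mu> \<Lambda> c d H (\<lambda>x. K * x powr \<alpha>) x = 0" if "x \<in> {0..1}" for x
      unfolding K_def using that assms kappa H_hat_eq [OF kappa, of \<Lambda> c d]
      by (intro hjb_lhs_const_mult_powr) (auto simp: H_def)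
    show "K * 0 powr \<alpha> = 0" by simp
  qed
  then show ?thesis
    using assms kappa H_hat_bounds I_alpha_pos set_integrable_I_integrand by (simp add: Phi H_def)
qed

end
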